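(* Let $\theta\in\mathbb{R}$. The subgroup ${}^{\ast}\mathbb{Z}(\theta)\subset{}^{\ast}\mathbb{Z}$ is an ideal of the ring ${}^{\ast}\mathbb{Z}$ if and only if $\theta\in\mathbb{Q}$; and in this case, if $\theta=a/b$ written in lowest terms, then $${}^{\ast}\mathbb{Z}(\theta)={}^{\ast}(b)\cong{}^{\ast}\mathbb{Z}.$$
   Context: Fix a non-principal ultrafilter on $\mathbb{N}$; ${}^{\ast}\mathbb{Z}\subset{}^{\ast}\mathbb{R}$ are the corresponding ultrapowers of $\mathbb{Z}$ and $\mathbb{R}$. Write $x\simeq y$ if $x-y$ is infinitesimal in ${}^{\ast}\mathbb{R}$ (the class of a sequence converging to $0$). For $\theta\in\mathbb{R}$, $${}^{\ast}\mathbb{Z}(\theta)=\{{}^{\ast}n\in{}^{\ast}\mathbb{Z}\mid \exists\,{}^{\ast}n^{\perp}\in{}^{\ast}\mathbb{Z}\text{ with }\theta\,{}^{\ast}n\simeq{}^{\ast}n^{\perp}\},$$ a subgroup of $({}^{\ast}\mathbb{Z},+)$. ${}^{\ast}(b)$ denotes the ultrapower of the ideal $(b)=b\mathbb{Z}$ (so ${}^{\ast}(b)=b\,{}^{\ast}\mathbb{Z}$), and the isomorphism with ${}^{\ast}\mathbb{Z}$ is one of additive groups. *)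

theory Defs
  imports Complex_Main "HOL-Algebra.Ideal"
begin

definition nonprincipal_ultrafilter :: "'a filter \<Rightarrow> bool" where
  "nonprincipal_ultrafilter U \<longleftrightarrow>
     U \<noteq> bot \<and> (\<forall>P. eventually P U \<or> eventually (\<lambda>x. \<not> P x) U) \<and> (\<forall>a. U \<noteq> principal {a})"

definition ultra_rel :: "nat filter \<Rightarrow> ((nat \<Rightarrow> 'a) \<times> (nat \<Rightarrow> 'a)) set" where
  "ultra_rel U = {(x, y). eventually (\<lambda>n. x n = y n) U}"

definition ultra_class :: "nat filter \<Rightarrow> (nat \<Rightarrow> 'a) \<Rightarrow> (nat \<Rightarrow> 'a) set" where
  "ultra_class U x = ultra_rel U `` {x}"

definition ultrapower :: "nat filter \<Rightarrow> (nat \<Rightarrow> 'a::comm_ring_1) set ring" where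
  "ultrapower U =
     \<lparr>carrier = UNIV // ultra_rel U,
      mult = (\<lambda>X Y. \<Union>x\<in>X. \<Union>y\<in>Y. ultra_class U (\<lambda>n. x n * y n)),
      one = ultra_class U (\<lambda>n. 1),
      zero = ultra_class U (\<lambda>n. 0),
      add = (\<lambda>X Y. \<Union>x\<in>X. \<Union>y\<in>Y. ultra_class U (\<lambda>n. x n + y n))\<rparr>"

definition ultra_set :: "nat filter \<Rightarrow> 'a set \<Rightarrow> (nat \<Rightarrow> 'a) set set" where
  "ultra_set U A = {ultra_class U x | x. \<forall>n. x n \<in> A}"

definition ultra_map :: "nat filter \<Rightarrow> ('a \<Rightarrow> 'b) \<Rightarrow> (nat \<Rightarrow> 'a) set \<Rightarrow> (nat \<Rightarrow> 'b) set" where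
  "ultra_map U f X = (\<Union>x\<in>X. ultra_class U (\<lambda>n. f (x n)))"

abbreviation star_int :: "nat filter \<Rightarrow> (nat \<Rightarrow> int) set ring" where
  "star_int U \<equiv> ultrapower U"

abbreviation star_real :: "nat filter \<Rightarrow> (nat \<Rightarrow> real) set ring" where
  "star_real U \<equiv> ultrapower U"

text \<open>
  An infinitesimal is the class of a genuinely convergent null sequence.  Unless the ultrafilter
  is a P-point, this is stronger than being bounded by every positive standard real.
\<close>

definition infinitesimal :: "nat filter \<Rightarrow> (nat \<Rightarrow> real) set \<Rightarrow> bool" where
  "infinitesimal U X \<longleftrightarrow> (\<exists>e. e \<longlonglongrightarrow> 0 \<and> X = ultra_class U e)"

definition infinitely_close :: "nat filter \<Rightarrow> (nat \<Rightarrow> real) set \<Rightarrow> (nat \<Rightarrow> real) set \<Rightarrow> bool" where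
  "infinitely_close U X Y \<longleftrightarrow> infinitesimal U (X \<ominus>\<^bsub>star_real U\<^esub> Y)"

text \<open>
  The inclusion of the hyperintegers in the hyperreals is \<open>ultra_map U real_of_int\<close>; the real
  number \<open>\<theta>\<close> is the class of the constant sequence.
\<close>

definition star_int_approx :: "nat filter \<Rightarrow> real \<Rightarrow> (nat \<Rightarrow> int) set set" where
  "star_int_approx U \<theta> =
     {N \<in> carrier (star_int U). \<exists>M \<in> carrier (star_int U).
        infinitely_close U
          (ultra_class U (\<lambda>n. \<theta>) \<otimes>\<^bsub>star_real U\<^esub> ultra_map U real_of_int N)
          (ultra_map U real_of_int M)}"

lemma equiv_ultra_rel: "equiv UNIV (ultra_rel U)"
proof (rule equivI)
  show "ultra_rel U \<subseteq> UNIV \<times> UNIV" by simp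
  show "refl_on UNIV (ultra_rel U)" by (auto simp: refl_on_def ultra_rel_def)
  show "sym (ultra_rel U)" by (auto simp: sym_def ultra_rel_def eq_commute)
  show "trans (ultra_rel U)"
    by (auto simp: trans_def ultra_rel_def elim: eventually_elim2)
qed

lemma ultra_class_eq_iff:
  "ultra_class U x = ultra_class U y \<longleftrightarrow> eventually (\<lambda>n. x n = y n) U"
  using eq_equiv_class_iff[OF equiv_ultra_rel, of x y U]
  by (simp add: ultra_class_def ultra_rel_def)

lemma mem_ultra_class_iff: "y \<in> ultra_class U x \<longleftrightarrow> eventually (\<lambda>n. x n = y n) U"
  by (simp add: ultra_class_def ultra_rel_def)

lemma ultra_class_self: "x \<in> ultra_class U x"
  by (simp add: mem_ultra_class_iff)

lemma carrier_ultrapower: "carrier (ultrapower U) = range (ultra_class U)"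
  by (auto simp: ultrapower_def quotient_def ultra_class_def)

lemma ultra_class_in_carrier [simp]: "ultra_class U x \<in> carrier (ultrapower U)"
  by (simp add: carrier_ultrapower)

lemma ultra_lift2:
  "(\<Union>x\<in>ultra_class U a. \<Union>y\<in>ultra_class U b. ultra_class U (\<lambda>n. f (x n) (y n)))
     = ultra_class U (\<lambda>n. f (a n) (b n))"
proof -
  have "ultra_class U (\<lambda>n. f (x n) (y n)) = ultra_class U (\<lambda>n. f (a n) (b n))"
    if "x \<in> ultra_class U a" "y \<in> ultra_class U b" for x y
    using that unfolding mem_ultra_class_iff ultra_class_eq_iff
    by eventually_elim simp
  then have "(\<Union>x\<in>ultra_class U a. \<Union>y\<in>ultra_class U b. ultra_class U (\<lambda>n. f (x n) (y n)))
    = (\<Union>x\<in>ultra_class U a. \<Union>y\<in>ultra_class U b. ultra_class U (\<lambda>n. f (a n) (b n)))"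
    by (intro SUP_cong refl)
  also have "\<dots> = ultra_class U (\<lambda>n. f (a n) (b n))"
    using ultra_class_self[of a U] ultra_class_self[of b U] by auto
  finally show ?thesis .
qed

lemma ultra_map_class [simp]: "ultra_map U f (ultra_class U a) = ultra_class U (\<lambda>n. f (a n))"
proof -
  have "ultra_class U (\<lambda>n. f (x n)) = ultra_class U (\<lambda>n. f (a n))"
    if "x \<in> ultra_class U a" for x
    using that unfolding mem_ultra_class_iff ultra_class_eq_iff
    by eventually_elim simp
  then show ?thesis unfolding ultra_map_def using ultra_class_self by blast
qed

lemma ultrapower_simps [simp]:
  "ultra_class U a \<otimes>\<^bsub>ultrapower U\<^esub> ultra_class U b = ultra_class U (\<lambda>n. a n * b n)"
  "ultra_class U a \<oplus>\<^bsub>ultrapower U\<^esub> ultra_class U b = ultra_class U (\<lambda>n. a n + b n)"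
  "\<one>\<^bsub>ultrapower U\<^esub> = ultra_class U (\<lambda>n. 1)"
  "\<zero>\<^bsub>ultrapower U\<^esub> = ultra_class U (\<lambda>n. 0)"
  by (simp_all add: ultrapower_def ultra_lift2)

lemma cring_ultrapower: "cring (ultrapower U)"
proof (rule cringI)
  show "abelian_group (ultrapower U)"
  proof (rule abelian_groupI)
    fix X assume "X \<in> carrier (ultrapower U)"
    then obtain x where X: "X = ultra_class U x" by (auto simp: carrier_ultrapower)
    show "\<exists>Y\<in>carrier (ultrapower U). Y \<oplus>\<^bsub>ultrapower U\<^esub> X = \<zero>\<^bsub>ultrapower U\<^esub>"
      by (rule bexI[of _ "ultra_class U (\<lambda>n. - x n)"]) (simp_all add: X)
  qed (auto simp: carrier_ultrapower add_ac)
  show "Group.comm_monoid (ultrapower U)"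
    by (rule comm_monoidI) (auto simp: carrier_ultrapower mult_ac)
qed (auto simp: carrier_ultrapower ring_distribs)

lemma ultrapower_a_inv [simp]:
  "\<ominus>\<^bsub>ultrapower U\<^esub> ultra_class U a = ultra_class U (\<lambda>n. - a n)"
proof -
  interpret cring "ultrapower U :: (nat \<Rightarrow> 'a) set ring" by (rule cring_ultrapower)
  show ?thesis by (rule minus_equality) simp_all
qed

lemma ultrapower_minus [simp]:
  "ultra_class U a \<ominus>\<^bsub>ultrapower U\<^esub> ultra_class U b = ultra_class U (\<lambda>n. a n - b n)"
  by (simp add: a_minus_def)

lemma ultra_class_mem_star_int_approx_iff:
  "ultra_class U x \<in> star_int_approx U \<theta> \<longleftrightarrow>
     (\<exists>y e. e \<longlonglongrightarrow> 0 \<and> eventually (\<lambda>n. \<theta> * real_of_int (x n) - real_of_int (y n) = e n) U)"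
  by (fastforce simp: star_int_approx_def carrier_ultrapower infinitely_close_def
      infinitesimal_def ultra_class_eq_iff)

lemma subgroup_star_int_approx:
  "subgroup (star_int_approx U \<theta>) (add_monoid (star_int U))"
proof -
  interpret R: cring "star_int U" by (rule cring_ultrapower)
  show ?thesis
  proof (rule R.add.subgroupI)
    show "star_int_approx U \<theta> \<subseteq> carrier (star_int U)"
      by (auto simp: star_int_approx_def)
    have "ultra_class U (\<lambda>n. 0) \<in> star_int_approx U \<theta>"
      unfolding ultra_class_mem_star_int_approx_iff
      by (rule exI[of _ "\<lambda>n. 0"], rule exI[of _ "\<lambda>n. 0"]) simp
    then show "star_int_approx U \<theta> \<noteq> {}" by blast
  next
    fix X assume X: "X \<in> star_int_approx U \<theta>"
    then obtain x where x: "X = ultra_class U x"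
      by (auto simp: star_int_approx_def carrier_ultrapower)
    obtain y e where e: "e \<longlonglongrightarrow> 0"
      "eventually (\<lambda>n. \<theta> * real_of_int (x n) - real_of_int (y n) = e n) U"
      using X unfolding x ultra_class_mem_star_int_approx_iff by blast
    show "\<ominus>\<^bsub>star_int U\<^esub> X \<in> star_int_approx U \<theta>"
      unfolding x ultrapower_a_inv ultra_class_mem_star_int_approx_iff
    proof (intro exI conjI)
      show "(\<lambda>n. - e n) \<longlonglongrightarrow> 0" using tendsto_minus[OF e(1)] by simp
      show "eventually (\<lambda>n. \<theta> * real_of_int (- x n) - real_of_int (- y n) = - e n) U"
        using e(2) by eventually_elim simp
    qed
  next
    fix X X' assume X: "X \<in> star_int_approx U \<theta>" and X': "X' \<in> star_int_approx U \<theta>"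
    then obtain x x' where x: "X = ultra_class U x" "X' = ultra_class U x'"
      by (auto simp: star_int_approx_def carrier_ultrapower)
    obtain y e where e: "e \<longlonglongrightarrow> 0"
      "eventually (\<lambda>n. \<theta> * real_of_int (x n) - real_of_int (y n) = e n) U"
      using X unfolding x ultra_class_mem_star_int_approx_iff by blast
    obtain y' e' where e': "e' \<longlonglongrightarrow> 0"
      "eventually (\<lambda>n. \<theta> * real_of_int (x' n) - real_of_int (y' n) = e' n) U"
      using X' unfolding x ultra_class_mem_star_int_approx_iff by blast
    show "X \<oplus>\<^bsub>star_int U\<^esub> X' \<in> star_int_approx U \<theta>"
      unfolding x ultrapower_simps ultra_class_mem_star_int_approx_iff
    proof (intro exI conjI)
      show "(\<lambda>n. e n + e' n) \<longlonglongrightarrow> 0" using tendsto_add[OF e(1) e'(1)] by simp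
      show "eventually (\<lambda>n. \<theta> * real_of_int (x n + x' n) - real_of_int (y n + y' n) = e n + e' n) U"
        using e(2) e'(2) by eventually_elim (simp add: algebra_simps)
    qed
  qed
qed

end

theory Submission
  imports Defs "HOL-Analysis.Kronecker_Approximation_Theorem"
begin

text \<open>
  Let \<open>\<theta> = a / b\<close> in lowest terms.  If \<open>\<theta> x - y\<close> agrees almost everywhere (along the ultrafilter) with a
  null sequence and \<open>x\<close>, \<open>y\<close> are integral, then so does \<open>a x - b y\<close>.  Being integral, it vanishes almost
  everywhere, so \<open>b\<close> divides \<open>a x\<^sub>n\<close> and hence \<open>x\<^sub>n\<close> for almost all \<open>n\<close>.  This identifies the subgroup with the multiples of \<open>b\<close>
  (\<open>star_int_approx_fraction\<close>), which form an ideal, and division by \<open>b\<close> is the isomorphism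
  onto the hyperintegers.

  If \<open>\<theta>\<close> is irrational, Dirichlet's theorem gives integers \<open>x\<^sub>n\<close> whose products \<open>\<theta> x\<^sub>n\<close> come
  arbitrarily close to the integers without being integers.  A small nonzero error can be amplified: some
  integer multiple \<open>k\<^sub>n x\<^sub>n\<close> has \<open>\<theta> k\<^sub>n x\<^sub>n\<close> at distance at least \<open>1/4\<close> from every integer
  (\<open>int_multiple_far_from_ints\<close>).  Thus the subgroup contains the class of \<open>x\<close> but not its
  product with the class of \<open>k\<close> (\<open>not_ideal_star_int_approx_irrational\<close>).

  Nonprincipality enters through \<open>nonprincipal_ultrafilter_le_sequentially\<close>: what holds for
  all large \<open>n\<close> holds almost everywhere, so that an infinitesimal is almost everywhere smaller than any
  positive real.
\<close>

section \<open>Infinitesimals along a nonprincipal ultrafilter\<close>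

lemma nonprincipal_ultrafilter_le_sequentially:
  assumes "nonprincipal_ultrafilter U"
  shows "U \<le> sequentially"
proof -
  \<comment> \<open>An ultrafilter that contains a singleton is the principal filter of that singleton.\<close>
  have ne: "eventually (\<lambda>n. n \<noteq> a) U" for a
  proof (rule ccontr)
    assume "\<not> eventually (\<lambda>n. n \<noteq> a) U"
    then have a: "eventually (\<lambda>n. n = a) U"
      using assms unfolding nonprincipal_ultrafilter_def by metis
    have "eventually P U \<longleftrightarrow> P a" for P
    proof
      assume "eventually P U"
      with a have "eventually (\<lambda>n. P a) U" by eventually_elim simp
      then show "P a"
        using assms by (simp add: nonprincipal_ultrafilter_def eventually_const_iff)
    next
      assume "P a"
      from a show "eventually P U" by eventually_elim (simp add: \<open>P a\<close>)
    qed
    then have "U = principal {a}" by (simp add: filter_eq_iff eventually_principal)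
    then show False using assms by (simp add: nonprincipal_ultrafilter_def)
  qed
  have lt: "eventually (\<lambda>n. \<forall>a\<in>{..<N}. n \<noteq> a) U" for N
    by (rule eventually_ball_finite) (simp_all add: ne)
  have ge: "eventually (\<lambda>n. N \<le> n) U" for N
    using lt[of N] by (rule eventually_mono) (metis lessThan_iff not_le)
  show ?thesis
  proof (rule filter_leI)
    fix P :: "nat \<Rightarrow> bool"
    assume "eventually P sequentially"
    then obtain N where N: "\<And>n. N \<le> n \<Longrightarrow> P n" by (auto simp: eventually_sequentially)
    show "eventually P U" using ge[of N] by eventually_elim (rule N)
  qed
qed

lemma eventually_infinitesimal_less:
  assumes "nonprincipal_ultrafilter U" and "e \<longlonglongrightarrow> (0::real)" and "0 < d"
  shows "eventually (\<lambda>n. \<bar>e n\<bar> < d) U"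
  using filter_leD[OF nonprincipal_ultrafilter_le_sequentially[OF assms(1)] tendstoD[OF assms(2,3)]]
  by simp

section \<open>The rational case\<close>

text \<open>
  A sequence that is divisible by \<open>b\<close> almost everywhere can be altered to consist of multiples of \<open>b\<close>
  throughout without changing its class.
\<close>

lemma ultra_class_mem_multiples_iff:
  "ultra_class U x \<in> ultra_set U (range (\<lambda>k. b * k)) \<longleftrightarrow> eventually (\<lambda>n. b dvd x n) U"
  for b :: int
proof
  assume "ultra_class U x \<in> ultra_set U (range (\<lambda>k. b * k))"
  then obtain z where z: "eventually (\<lambda>n. x n = z n) U" "\<forall>n. z n \<in> range (\<lambda>k. b * k)"
    by (auto simp: ultra_set_def ultra_class_eq_iff)
  from z(1) show "eventually (\<lambda>n. b dvd x n) U"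
  proof eventually_elim
    case (elim n)
    with z(2) show ?case by (metis dvd_triv_left imageE)
  qed
next
  assume "eventually (\<lambda>n. b dvd x n) U"
  then have "eventually (\<lambda>n. x n = b * (x n div b)) U" by eventually_elim simp
  then have "ultra_class U x = ultra_class U (\<lambda>n. b * (x n div b))"
    by (simp add: ultra_class_eq_iff)
  then show "ultra_class U x \<in> ultra_set U (range (\<lambda>k. b * k))"
    unfolding ultra_set_def by blast
qed

lemma star_int_approx_fraction:
  fixes a b :: int
  assumes U: "nonprincipal_ultrafilter U" and b: "b \<noteq> 0" and ab: "coprime a b"
    and \<theta>: "\<theta> = real_of_int a / real_of_int b"
  shows "star_int_approx U \<theta> = ultra_set U (range (\<lambda>k. b * k))"
proof -
  have mem: "ultra_class U x \<in> star_int_approx U \<theta> \<longleftrightarrow> eventually (\<lambda>n. b dvd x n) U" for x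
  proof
    assume "ultra_class U x \<in> star_int_approx U \<theta>"
    then obtain y e where e: "e \<longlonglongrightarrow> 0"
      and xy: "eventually (\<lambda>n. \<theta> * real_of_int (x n) - real_of_int (y n) = e n) U"
      unfolding ultra_class_mem_star_int_approx_iff by blast
    have "eventually (\<lambda>n. \<bar>e n\<bar> < 1 / \<bar>real_of_int b\<bar>) U"
      using eventually_infinitesimal_less[OF U e] b by simp
    with xy show "eventually (\<lambda>n. b dvd x n) U"
    proof eventually_elim
      case (elim n)
      have "real_of_int (a * x n - b * y n) = real_of_int b * e n"
        unfolding elim(1)[symmetric] using b by (simp add: \<theta> field_simps)
      then have "\<bar>real_of_int (a * x n - b * y n)\<bar> < 1"
        using elim(2) b by (simp add: abs_mult field_simps)
      then have "a * x n = b * y n" by linarith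
      then have "b dvd a * x n" by simp
      then show ?case using ab by (simp add: coprime_commute coprime_dvd_mult_right_iff)
    qed
  next
    assume dvd: "eventually (\<lambda>n. b dvd x n) U"
    show "ultra_class U x \<in> star_int_approx U \<theta>"
      unfolding ultra_class_mem_star_int_approx_iff
    proof (intro exI conjI)
      show "(\<lambda>n. 0 :: real) \<longlonglongrightarrow> 0" by simp
      show "eventually (\<lambda>n. \<theta> * real_of_int (x n) - real_of_int (a * (x n div b)) = 0) U"
        using dvd by eventually_elim (use b in \<open>auto simp: \<theta> elim!: dvdE\<close>)
    qed
  qed
  have "X \<in> range (ultra_class U)"
    if "X \<in> star_int_approx U \<theta> \<or> X \<in> ultra_set U (range (\<lambda>k. b * k))" for X
    using that by (auto simp: star_int_approx_def carrier_ultrapower ultra_set_def)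
  then show ?thesis
    using mem ultra_class_mem_multiples_iff[of U _ b] by blast
qed

lemma ideal_multiples:
  fixes b :: int
  shows "ideal (ultra_set U (range (\<lambda>k. b * k))) (star_int U)"
proof (rule idealI)
  let ?I = "ultra_set U (range (\<lambda>k. b * k))"
  interpret R: cring "star_int U" by (rule cring_ultrapower)
  show "ring (star_int U)" by (rule R.ring_axioms)
  have rep: "\<exists>x. X = ultra_class U x \<and> eventually (\<lambda>n. b dvd x n) U" if X: "X \<in> ?I" for X
  proof -
    obtain x where "X = ultra_class U x" using X unfolding ultra_set_def by blast
    with X show ?thesis by (auto simp: ultra_class_mem_multiples_iff)
  qed
  show "subgroup ?I (add_monoid (star_int U))"
  proof (rule R.add.subgroupI)
    show "?I \<subseteq> carrier (star_int U)" by (auto simp: ultra_set_def)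
    have "ultra_class U (\<lambda>n. 0) \<in> ?I" by (simp add: ultra_class_mem_multiples_iff)
    then show "?I \<noteq> {}" by blast
  next
    fix X assume "X \<in> ?I"
    then obtain x where x: "X = ultra_class U x" "eventually (\<lambda>n. b dvd x n) U"
      using rep by blast
    then show "\<ominus>\<^bsub>star_int U\<^esub> X \<in> ?I"
      by (simp add: ultra_class_mem_multiples_iff)
  next
    fix X Y assume "X \<in> ?I" "Y \<in> ?I"
    then obtain x y where x: "X = ultra_class U x" "eventually (\<lambda>n. b dvd x n) U"
      and y: "Y = ultra_class U y" "eventually (\<lambda>n. b dvd y n) U"
      using rep by metis
    show "X \<oplus>\<^bsub>star_int U\<^esub> Y \<in> ?I"
      unfolding x(1) y(1) ultrapower_simps ultra_class_mem_multiples_iff using x(2) y(2)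
      by eventually_elim simp
  qed
  fix X Y assume "X \<in> ?I" and "Y \<in> carrier (star_int U)"
  then obtain x y where x: "X = ultra_class U x" "eventually (\<lambda>n. b dvd x n) U"
    and y: "Y = ultra_class U y"
    using rep by (metis carrier_ultrapower imageE)
  show "Y \<otimes>\<^bsub>star_int U\<^esub> X \<in> ?I"
    unfolding x(1) y ultrapower_simps ultra_class_mem_multiples_iff using x(2)
    by eventually_elim simp
  show "X \<otimes>\<^bsub>star_int U\<^esub> Y \<in> ?I"
    unfolding x(1) y ultrapower_simps ultra_class_mem_multiples_iff using x(2)
    by eventually_elim simp
qed

lemma multiples_iso_star_int:
  fixes b :: int
  assumes b: "b \<noteq> 0"
  shows "(add_monoid (star_int U))\<lparr>carrier := ultra_set U (range (\<lambda>k. b * k))\<rparr>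
           \<cong> add_monoid (star_int U)"
proof (rule is_isoI, rule isoI)
  let ?I = "ultra_set U (range (\<lambda>k. b * k))"
  let ?G = "(add_monoid (star_int U))\<lparr>carrier := ?I\<rparr>"
  let ?h = "ultra_map U (\<lambda>m. m div b)"
  have rep: "\<exists>k. X = ultra_class U (\<lambda>n. b * k n)" if X: "X \<in> ?I" for X
  proof -
    obtain x where x: "X = ultra_class U x" "\<forall>n. x n \<in> range (\<lambda>k. b * k)"
      using X unfolding ultra_set_def by blast
    from x(2) have "\<forall>n. \<exists>k. x n = b * k" by blast
    then obtain k where "\<forall>n. x n = b * k n" by metis
    then have "x = (\<lambda>n. b * k n)" by auto
    with x(1) show ?thesis by blast
  qed
  have mem: "ultra_class U (\<lambda>n. b * k n) \<in> ?I" for k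
    by (simp add: ultra_class_mem_multiples_iff)
  have h: "?h (ultra_class U (\<lambda>n. b * k n)) = ultra_class U k" for k
    using b by simp
  show "?h \<in> hom ?G (add_monoid (star_int U))"
  proof (rule homI)
    fix X assume "X \<in> carrier ?G"
    then show "?h X \<in> carrier (add_monoid (star_int U))"
      using rep[of X] h by auto
  next
    fix X Y assume "X \<in> carrier ?G" "Y \<in> carrier ?G"
    then obtain k l where "X = ultra_class U (\<lambda>n. b * k n)" "Y = ultra_class U (\<lambda>n. b * l n)"
      using rep[of X] rep[of Y] by auto
    then show "?h (X \<otimes>\<^bsub>?G\<^esub> Y) = ?h X \<otimes>\<^bsub>add_monoid (star_int U)\<^esub> ?h Y"
      using h[of k] h[of l] h[of "\<lambda>n. k n + l n"] by (simp add: distrib_left)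
  qed
  show "bij_betw ?h (carrier ?G) (carrier (add_monoid (star_int U)))"
  proof (rule bij_betwI[where g = "ultra_map U (\<lambda>m. b * m)"])
    show "?h \<in> carrier ?G \<rightarrow> carrier (add_monoid (star_int U))"
      using rep h by fastforce
    show "ultra_map U (\<lambda>m. b * m) \<in> carrier (add_monoid (star_int U)) \<rightarrow> carrier ?G"
      using mem by (auto simp: carrier_ultrapower)
    show "ultra_map U (\<lambda>m. b * m) (?h X) = X" if "X \<in> carrier ?G" for X
      using that rep[of X] h by auto
    show "?h (ultra_map U (\<lambda>m. b * m) X) = X" if "X \<in> carrier (add_monoid (star_int U))" for X
      using that b by (auto simp: carrier_ultrapower)
  qed
qed

section \<open>The irrational case\<close>

text \<open>
  Steps of length \<open>0 < \<bar>\<delta>\<bar> < 1/4\<close> from the origin cannot jump over the interval from \<open>1/4\<close> to \<open>1/2\<close>, all of whose points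
  have distance at least \<open>1/4\<close> from the integers.
\<close>

lemma int_multiple_far_from_ints:
  fixes \<delta> :: real
  assumes "\<delta> \<noteq> 0" and "\<bar>\<delta>\<bar> < 1 / 4"
  obtains k :: int where "\<And>m :: int. 1 / 4 \<le> \<bar>of_int k * \<delta> - of_int m\<bar>"
proof
  \<comment> \<open>the largest number of steps that stays within \<open>1/2\<close>\<close>
  define k where "k = \<lfloor>1 / (2 * \<bar>\<delta>\<bar>)\<rfloor>"
  have pos: "0 < \<bar>\<delta>\<bar>" using assms(1) by simp
  have "of_int k \<le> 1 / (2 * \<bar>\<delta>\<bar>)" "1 / (2 * \<bar>\<delta>\<bar>) < of_int k + 1"
    unfolding k_def by linarith+
  with pos have le: "of_int k * \<bar>\<delta>\<bar> \<le> 1 / 2" and "1 / 2 < of_int k * \<bar>\<delta>\<bar> + \<bar>\<delta>\<bar>"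
    by (simp_all add: field_simps)
  with assms(2) have ge: "1 / 4 \<le> of_int k * \<bar>\<delta>\<bar>" by linarith
  have cases: "of_int k * \<delta> = of_int k * \<bar>\<delta>\<bar> \<or> of_int k * \<delta> = - (of_int k * \<bar>\<delta>\<bar>)"
    by (auto simp: abs_if)
  show "1 / 4 \<le> \<bar>of_int k * \<delta> - of_int m\<bar>" for m :: int
  proof -
    have "m \<le> - 1 \<or> m = 0 \<or> 1 \<le> m" by linarith
    then have "real_of_int m \<le> - 1 \<or> real_of_int m = 0 \<or> 1 \<le> real_of_int m" by linarith
    with cases le ge show ?thesis by linarith
  qed
qed

lemma irrational_dirichlet_sequence:
  fixes \<theta> :: real
  assumes "\<theta> \<notin> \<rat>"
  obtains x y :: "nat \<Rightarrow> int"
  where "\<And>n. \<theta> * of_int (x n) - of_int (y n) \<noteq> 0"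
    and "(\<lambda>n. \<theta> * of_int (x n) - of_int (y n)) \<longlonglongrightarrow> 0"
    and "\<And>n. \<bar>\<theta> * of_int (x n) - of_int (y n)\<bar> < 1 / 4"
proof -
  \<comment> \<open>The offset 4 makes the bound \<open>1/4\<close> hold from the first term on.\<close>
  have "\<exists>x y. 0 < x \<and> \<bar>\<theta> * of_int x - of_int y\<bar> < 1 / real (n + 4)" for n
  proof -
    obtain y x where "0 < x" "\<bar>of_int x * \<theta> - of_int y\<bar> < 1 / real (n + 4)"
      by (rule Dirichlet_approx[of "n + 4" \<theta>]) (use that in auto)
    then show ?thesis by (auto simp: mult.commute)
  qed
  then obtain x y :: "nat \<Rightarrow> int" where x: "\<And>n. 0 < x n"
    and xy: "\<And>n. \<bar>\<theta> * of_int (x n) - of_int (y n)\<bar> < 1 / real (n + 4)"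
    by metis
  show thesis
  proof (rule that)
    show "\<theta> * of_int (x n) - of_int (y n) \<noteq> 0" for n
    proof
      assume "\<theta> * of_int (x n) - of_int (y n) = 0"
      then have "\<theta> = of_int (y n) / of_int (x n)"
        using x[of n] by (simp add: field_simps)
      then show False using assms by simp
    qed
    show "\<bar>\<theta> * of_int (x n) - of_int (y n)\<bar> < 1 / 4" for n
    proof -
      have "1 / real (n + 4) \<le> 1 / 4" by (simp add: field_simps)
      with xy[of n] show ?thesis by linarith
    qed
    have "(\<lambda>n. 1 / real (n + 4)) \<longlonglongrightarrow> 0"
      by (rule LIMSEQ_ignore_initial_segment[OF lim_1_over_n])
    then show "(\<lambda>n. \<theta> * of_int (x n) - of_int (y n)) \<longlonglongrightarrow> 0"
      by (rule Lim_null_comparison[rotated]) (use xy in \<open>auto intro: always_eventually less_imp_le\<close>)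
  qed
qed

lemma not_ideal_star_int_approx_irrational:
  assumes U: "nonprincipal_ultrafilter U" and \<theta>: "\<theta> \<notin> \<rat>"
  shows "\<not> ideal (star_int_approx U \<theta>) (star_int U)"
proof
  assume I: "ideal (star_int_approx U \<theta>) (star_int U)"
  obtain x y :: "nat \<Rightarrow> int" where nz: "\<And>n. \<theta> * of_int (x n) - of_int (y n) \<noteq> 0"
    and lim: "(\<lambda>n. \<theta> * of_int (x n) - of_int (y n)) \<longlonglongrightarrow> 0"
    and small: "\<And>n. \<bar>\<theta> * of_int (x n) - of_int (y n)\<bar> < 1 / 4"
    using irrational_dirichlet_sequence[OF \<theta>] by blast
  have "\<exists>k::int. \<forall>m::int. 1 / 4 \<le> \<bar>of_int k * (\<theta> * of_int (x n) - of_int (y n)) - of_int m\<bar>" for n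
    using int_multiple_far_from_ints[OF nz small] by metis
  then obtain k :: "nat \<Rightarrow> int" where
    far: "\<And>n m. 1 / 4 \<le> \<bar>of_int (k n) * (\<theta> * of_int (x n) - of_int (y n)) - of_int m\<bar>"
    by metis
  have "ultra_class U x \<in> star_int_approx U \<theta>"
    unfolding ultra_class_mem_star_int_approx_iff using lim
    by (auto intro!: exI[of _ y] exI[of _ "\<lambda>n. \<theta> * of_int (x n) - of_int (y n)"])
  then have "ultra_class U k \<otimes>\<^bsub>star_int U\<^esub> ultra_class U x \<in> star_int_approx U \<theta>"
    by (rule ideal.I_l_closed[OF I]) simp
  then obtain z e where e: "e \<longlonglongrightarrow> 0"
    and z: "eventually (\<lambda>n. \<theta> * real_of_int (k n * x n) - real_of_int (z n) = e n) U"
    unfolding ultrapower_simps ultra_class_mem_star_int_approx_iff by blast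
  have "eventually (\<lambda>n. \<bar>e n\<bar> < 1 / 4) U"
    by (rule eventually_infinitesimal_less[OF U e]) simp
  with z have "eventually (\<lambda>n. False) U"
  proof eventually_elim
    case (elim n)
    have "of_int (k n) * (\<theta> * of_int (x n) - of_int (y n)) - of_int (z n - k n * y n) = e n"
      unfolding elim(1)[symmetric] by (simp add: algebra_simps)
    with far[of n "z n - k n * y n"] elim(2) show ?case by simp
  qed
  then show False using U by (simp add: nonprincipal_ultrafilter_def eventually_const_iff)
qed

section \<open>The characterization\<close>

theorem theorem1:
  fixes U :: "nat filter" and \<theta> :: real
  assumes "nonprincipal_ultrafilter U"
  shows "(ideal (star_int_approx U \<theta>) (star_int U) \<longleftrightarrow> \<theta> \<in> \<rat>) \<and>
         (\<forall>a b :: int. b \<noteq> 0 \<longrightarrow> coprime a b \<longrightarrow> \<theta> = real_of_int a / real_of_int b \<longrightarrow>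
            star_int_approx U \<theta> = ultra_set U (range (\<lambda>k. b * k)) \<and>
            (add_monoid (star_int U))\<lparr>carrier := star_int_approx U \<theta>\<rparr> \<cong> add_monoid (star_int U))"
proof (intro conjI allI impI iffI)
  assume "ideal (star_int_approx U \<theta>) (star_int U)"
  then show "\<theta> \<in> \<rat>" using not_ideal_star_int_approx_irrational[OF assms] by blast
next
  assume "\<theta> \<in> \<rat>"
  then obtain a b :: int where "b > 0" "coprime a b" "\<theta> = of_int a / of_int b"
    by (rule Rats_cases')
  then have "star_int_approx U \<theta> = ultra_set U (range (\<lambda>k. b * k))"
    by (intro star_int_approx_fraction[OF assms]) auto
  then show "ideal (star_int_approx U \<theta>) (star_int U)"
    using ideal_multiples[of U b] by simp
next
  fix a b :: int
  assume b: "b \<noteq> 0" and ab: "coprime a b" "\<theta> = real_of_int a / real_of_int b"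
  show eq: "star_int_approx U \<theta> = ultra_set U (range (\<lambda>k. b * k))"
    by (rule star_int_approx_fraction[OF assms b ab])
  show "(add_monoid (star_int U))\<lparr>carrier := star_int_approx U \<theta>\<rparr> \<cong> add_monoid (star_int U)"
    unfolding eq by (rule multiples_iso_star_int[OF b])
qed

end
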